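(* Let $\mathcal{P}$ and $\mathcal{Q}$ be posets on disjoint finite sets $S$ and $T$, respectively. If $\eta\in\mathrm{NN}(\mathcal{P},q)$ and $\nu\in\mathrm{NN}(\mathcal{Q},q)$, then $$\mu_{\mathcal{P},\mathcal{Q}}(p_\eta\otimes p_\nu)=p_{\eta\sqcup\nu}.$$
   Context: $\mathbb{F}_q$ is the field with $q$ elements. For a poset $\mathcal{P}$ on a finite set $I$, the pattern group $U_\mathcal{P}$ is the group of matrices $g=1+x$, where $x=(x_{ij})_{i,j\in I}$ over $\mathbb{F}_q$ has $x_{ij}=0$ unless $i\prec_\mathcal{P}j$. An $(\mathbb{F}_q,\mathcal{P})$-set partition is a set $\eta$ of labeled arcs $i\overset{a}{\frown}j$ ($i,j\in I$, $a\in\mathbb{F}_q^\times$, at most one label for each pair) such that (1) $i\prec_\mathcal{P}j$ for every arc; (2) if $i\overset{a}{\frown}j\in\eta$ and $i\prec_\mathcal{P}k\prec_\mathcal{P}j$, then $\eta$ has no arc from $i$ to $k$ and none from $k$ to $j$ (with any label). It is nonnesting if there are no arcs $i\overset{a}{\frown}j,k\overset{b}{\frown}l\in\eta$ with $i\prec_\mathcal{P}k\prec_\mathcal{P}l\prec_\mathcal{P}j$. $\mathrm{NN}(\mathcal{P},q)$ is the set of nonnesting $(\mathbb{F}_q,\mathcal{P})$-set partitions. For $g\in U_\mathcal{P}$, $\mathrm{sml}(g)\in\mathrm{NN}(\mathcal{P},q)$ is the set of arcs $i\overset{g_{ij}}{\frown}j$ with $i\prec_\mathcal{P}j$, $g_{ij}\neq0$,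 and $g_{kl}=0$ whenever $(k,l)\neq(i,j)$ and $i\preceq_\mathcal{P}k\prec_\mathcal{P}l\preceq_\mathcal{P}j$. For $\nu\in\mathrm{NN}(\mathcal{P},q)$, $\kappa_\nu:U_\mathcal{P}\to\mathbb{C}$ is the indicator function of $K_\nu=\{g\in U_\mathcal{P}\mid\mathrm{sml}(g)=\nu\}$. For $\eta\in\mathrm{NN}(\mathcal{P},q)$, $$p_\eta=\sum_{\nu\in\mathrm{NN}(\mathcal{P},q),\ \eta\subseteq\nu}\kappa_\nu,$$ where $\eta\subseteq\nu$ means containment of sets of labeled arcs. For posets $\mathcal{P}$ on $S$ and $\mathcal{Q}$ on $T$ ($S,T$ disjoint), $\mathcal{P}\cdot\mathcal{Q}$ is the poset on $S\sqcup T$ with $x\prec y$ iff $x,y\in S$ and $x\prec_\mathcal{P}y$, or $x,y\in T$ and $x\prec_\mathcal{Q}y$, or $x\in S$ and $y\in T$. For $\eta\in\mathrm{NN}(\mathcal{P},q)$, $\nu\in\mathrm{NN}(\mathcal{Q},q)$, $\eta\sqcup\nu$ is the union of the two arc sets; it is a nonnesting $(\mathbb{F}_q,\mathcal{P}\cdot\mathcal{Q})$-set partition. For functions $\alpha:U_\mathcal{P}\to\mathbb{C}$ and $\beta:U_\mathcal{Q}\to\mathbb{C}$, $\mu_{\mathcal{P},\mathcal{Q}}(\alpha\otimes\beta)$ is the function on $U_{\mathcal{P}\cdot\mathcal{Q}}$ given by $g\mapsto\alpha(g_S)\beta(g_T)$, where $g_S,g_T$ are the submatrices of $g$ indexed by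 $S$ and by $T$. *)

theory Defs
  imports Complex_Main "HOL-Library.Indicator_Function"
begin

text \<open>
  A poset on a set \<open>I\<close> is given by its weak order, a relation \<open>P\<close> with
  \<^term>\<open>partial_order_on I P\<close>.  The field with \<open>q\<close> elements is a type \<open>'k\<close> of class \<open>field\<close>
  and \<open>finite\<close>, so that \<open>q\<close> is the cardinality of \<open>'k\<close>.
\<close>

definition strict_in :: "'i rel \<Rightarrow> 'i \<Rightarrow> 'i \<Rightarrow> bool" where
  "strict_in P i j \<longleftrightarrow> (i, j) \<in> P \<and> i \<noteq> j"

text \<open>
  The sum of two posets on disjoint sets that places all of \<open>S\<close> below all of \<open>T\<close>,
  again given by its weak order.
\<close>

definition poset_dot :: "'i set \<Rightarrow> 'i rel \<Rightarrow> 'i set \<Rightarrow> 'i rel \<Rightarrow> 'i rel" where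
  "poset_dot S P T Q = P \<union> Q \<union> S \<times> T"

text \<open>
  A matrix with rows and columns indexed by \<open>I\<close> is a function on all pairs of indices that
  is \<open>0\<close> outside \<open>I \<times> I\<close>; in particular the identity matrix depends on \<open>I\<close>.
\<close>

type_synonym ('i, 'k) mat_fun = "'i \<Rightarrow> 'i \<Rightarrow> 'k"

definition one_mat_on :: "'i set \<Rightarrow> ('i, 'k::field) mat_fun" where
  "one_mat_on I = (\<lambda>i j. if i \<in> I \<and> i = j then 1 else 0)"

definition submatrix_on :: "'i set \<Rightarrow> ('i, 'k::field) mat_fun \<Rightarrow> ('i, 'k) mat_fun" where
  "submatrix_on S g = (\<lambda>i j. if i \<in> S \<and> j \<in> S then g i j else 0)"

text \<open>
  The underlying set of the pattern group.  Only functions on this set are considered below,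
  so its multiplication is not needed.
\<close>

definition pattern_group :: "'i set \<Rightarrow> 'i rel \<Rightarrow> ('i, 'k::field) mat_fun set" where
  "pattern_group I P =
     {g. \<exists>x. (\<forall>i j. \<not> strict_in P i j \<longrightarrow> x i j = 0) \<and>
             g = (\<lambda>i j. one_mat_on I i j + x i j)}"

text \<open>The triple \<open>(i, a, j)\<close> is the arc from \<open>i\<close> to \<open>j\<close> with label \<open>a\<close>.\<close>

type_synonym ('i, 'k) arc = "'i \<times> 'k \<times> 'i"

definition labeled_set_partition :: "'i set \<Rightarrow> 'i rel \<Rightarrow> ('i, 'k::field) arc set \<Rightarrow> bool" where
  "labeled_set_partition I P \<eta> \<longleftrightarrow>
     \<eta> \<subseteq> I \<times> (UNIV - {0}) \<times> I \<and>
     (\<forall>i j a b. (i, a, j) \<in> \<eta> \<and> (i, b, j) \<in> \<eta> \<longrightarrow> a = b) \<and>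
     (\<forall>i a j. (i, a, j) \<in> \<eta> \<longrightarrow> strict_in P i j) \<and>
     (\<forall>i a j k. (i, a, j) \<in> \<eta> \<and> strict_in P i k \<and> strict_in P k j \<longrightarrow>
        (\<forall>b. (i, b, k) \<notin> \<eta>) \<and> (\<forall>b. (k, b, j) \<notin> \<eta>))"

definition nonnesting :: "'i rel \<Rightarrow> ('i, 'k) arc set \<Rightarrow> bool" where
  "nonnesting P \<eta> \<longleftrightarrow>
     \<not> (\<exists>i a j k b l. (i, a, j) \<in> \<eta> \<and> (k, b, l) \<in> \<eta> \<and>
          strict_in P i k \<and> strict_in P k l \<and> strict_in P l j)"

definition NN :: "'i set \<Rightarrow> 'i rel \<Rightarrow> ('i, 'k::field) arc set set" where
  "NN I P = {\<eta>. labeled_set_partition I P \<eta> \<and> nonnesting P \<eta>}"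

definition sml :: "'i rel \<Rightarrow> ('i, 'k::field) mat_fun \<Rightarrow> ('i, 'k) arc set" where
  "sml P g =
     {(i, a, j). strict_in P i j \<and> a = g i j \<and> g i j \<noteq> 0 \<and>
        (\<forall>k l. (k, l) \<noteq> (i, j) \<and> (i, k) \<in> P \<and> strict_in P k l \<and> (l, j) \<in> P \<longrightarrow> g k l = 0)}"

definition K_class :: "'i set \<Rightarrow> 'i rel \<Rightarrow> ('i, 'k::field) arc set \<Rightarrow> ('i, 'k) mat_fun set" where
  "K_class I P \<nu> = {g \<in> pattern_group I P. sml P g = \<nu>}"

text \<open>
  Complex functions on a pattern group are functions on all matrices, of which only the values
  on \<^const>\<open>pattern_group\<close> matter.
\<close>

definition kappa ::
  "'i set \<Rightarrow> 'i rel \<Rightarrow> ('i, 'k::field) arc set \<Rightarrow> ('i, 'k) mat_fun \<Rightarrow> complex" where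
  "kappa I P \<nu> = indicator (K_class I P \<nu>)"

definition p_fun ::
  "'i set \<Rightarrow> 'i rel \<Rightarrow> ('i, 'k::field) arc set \<Rightarrow> ('i, 'k) mat_fun \<Rightarrow> complex" where
  "p_fun I P \<eta> = (\<lambda>g. \<Sum>\<nu> | \<nu> \<in> NN I P \<and> \<eta> \<subseteq> \<nu>. kappa I P \<nu> g)"

text \<open>
  \<open>mu_prod S T \<alpha> \<beta>\<close> is the image of the pure tensor of \<open>\<alpha>\<close> and \<open>\<beta>\<close> under the multiplication
  map; it depends on the two posets only through their underlying sets.
\<close>

definition mu_prod ::
  "'i set \<Rightarrow> 'i set \<Rightarrow> (('i, 'k::field) mat_fun \<Rightarrow> complex) \<Rightarrow> (('i, 'k) mat_fun \<Rightarrow> complex) \<Rightarrow>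
     ('i, 'k) mat_fun \<Rightarrow> complex" where
  "mu_prod S T \<alpha> \<beta> = (\<lambda>g. \<alpha> (submatrix_on S g) * \<beta> (submatrix_on T g))"

end

theory Submission
  imports Defs
begin

text \<open>
  Since \<open>sml\<close> maps the pattern group into the nonnesting set partitions, the value of
  \<^const>\<open>p_fun\<close> at \<open>g\<close> is \<open>1\<close> if \<open>\<eta> \<subseteq> sml g\<close> and \<open>0\<close> otherwise.  Both \<open>S\<close> and \<open>T\<close> are convex
  in the ordinal sum, so whether an arc with both ends in \<open>S\<close> (or both in \<open>T\<close>) belongs to
  \<open>sml g\<close> is decided by the submatrix of \<open>g\<close> on that block.
\<close>

text \<open>The existential over \<open>x\<close> is eliminated: \<open>x\<close> can only be
  \<open>g\<close> minus the identity.\<close>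

lemma mem_pattern_group_iff:
  "g \<in> pattern_group I P \<longleftrightarrow> (\<forall>i j. \<not> strict_in P i j \<longrightarrow> g i j = one_mat_on I i j)"
proof
  assume "\<forall>i j. \<not> strict_in P i j \<longrightarrow> g i j = one_mat_on I i j"
  then show "g \<in> pattern_group I P"
    unfolding pattern_group_def
    by (intro CollectI exI[of _ "\<lambda>i j. g i j - one_mat_on I i j"]) auto
qed (auto simp: pattern_group_def)

lemma NN_subset: "\<eta> \<in> NN I P \<Longrightarrow> \<eta> \<subseteq> I \<times> (UNIV - {0}) \<times> I"
  by (simp add: NN_def labeled_set_partition_def)

lemma finite_NN: "finite I \<Longrightarrow> finite (NN I P :: ('i, 'k::{field, finite}) arc set set)"
  by (rule finite_subset[of _ "Pow (I \<times> (UNIV - {0}) \<times> I)"]) (use NN_subset in blast, simp)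

text \<open>Arcs of \<open>sml P g\<close> carry nonzero entries, while every other entry inside the
  interval of an arc vanishes. This excludes conflicts at a common endpoint as well as
  nesting.\<close>

lemma sml_in_NN:
  assumes "partial_order_on I P"
  shows "sml P g \<in> NN I P"
proof -
  have sub: "P \<subseteq> I \<times> I" and refl: "\<And>x. x \<in> I \<Longrightarrow> (x, x) \<in> P"
    using assms by (auto simp: partial_order_on_def preorder_on_def refl_on_def)
  have "labeled_set_partition I P (sml P g)"
    unfolding labeled_set_partition_def
  proof (intro conjI allI impI)
    show "sml P g \<subseteq> I \<times> (UNIV - {0}) \<times> I"
      using sub by (auto simp: sml_def strict_in_def)
  next
    fix i j a b
    assume "(i, a, j) \<in> sml P g \<and> (i, b, j) \<in> sml P g"
    then show "a = b" by (auto simp: sml_def)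
  next
    fix i a j
    assume "(i, a, j) \<in> sml P g"
    then show "strict_in P i j" by (auto simp: sml_def)
  next
    fix i a j k b
    assume *: "(i, a, j) \<in> sml P g \<and> strict_in P i k \<and> strict_in P k j"
    \<comment> \<open>The pairs (i, k) and (k, j) share an endpoint with (i, j), so reflexivity at
      that endpoint brings them under the vanishing condition.\<close>
    then have "g i k = 0"
      using sub refl by (auto simp: sml_def strict_in_def)
    then show "(i, b, k) \<notin> sml P g" by (auto simp: sml_def)
    have "g k j = 0"
      using * sub refl by (auto simp: sml_def strict_in_def)
    then show "(k, b, j) \<notin> sml P g" by (auto simp: sml_def)
  qed
  moreover have "nonnesting P (sml P g)"
    unfolding nonnesting_def sml_def strict_in_def by blast
  ultimately show ?thesis by (simp add: NN_def)
qed

lemma p_fun_eq: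
  fixes g :: "('i, 'k::{field, finite}) mat_fun"
  assumes "finite I" "partial_order_on I P" "g \<in> pattern_group I P"
  shows "p_fun I P \<eta> g = of_bool (\<eta> \<subseteq> sml P g)"
proof -
  have "p_fun I P \<eta> g = (\<Sum>\<nu> | \<nu> \<in> NN I P \<and> \<eta> \<subseteq> \<nu>. if \<nu> = sml P g then 1 else 0)"
    unfolding p_fun_def using assms(3)
    by (intro sum.cong) (auto simp: kappa_def K_class_def indicator_def)
  \<comment> \<open>Finiteness of the index set matters here: over an infinite set the sum would be
    0 by convention.\<close>
  also have "\<dots> = of_bool (\<eta> \<subseteq> sml P g)"
    using finite_NN[OF assms(1), of P] sml_in_NN[OF assms(2), of g]
    by (subst sum.delta) auto
  finally show ?thesis .
qed

text \<open>Enlarging \<open>P\<close> only frees entries: a pair in S \<times> S that is not strict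
  in \<open>P\<close> is not strict in \<open>R\<close> either, and there \<open>g\<close> agrees
  with the identity.\<close>

lemma submatrix_in_pattern_group:
  assumes "g \<in> pattern_group I R" "S \<subseteq> I" "R \<inter> S \<times> S \<subseteq> P"
  shows "submatrix_on S g \<in> pattern_group S P"
  unfolding mem_pattern_group_iff
proof (intro allI impI)
  fix i j
  assume *: "\<not> strict_in P i j"
  have "g i j = one_mat_on I i j" if "i \<in> S" "j \<in> S"
  proof -
    have "\<not> strict_in R i j"
      using * that assms(3) by (auto simp: strict_in_def)
    then show ?thesis
      using assms(1) by (simp add: mem_pattern_group_iff)
  qed
  then show "submatrix_on S g i j = one_mat_on S i j"
    using assms(2) by (auto simp: submatrix_on_def one_mat_on_def)
qed

text \<open>Membership of an arc in \<open>sml\<close> is tested only on pairs between its ends;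
  convexity keeps these in \<open>S\<close>, where both orders and both matrices agree.\<close>

lemma sml_submatrix_iff:
  assumes "P = R \<inter> S \<times> S"
    and convex: "\<And>i j k. i \<in> S \<Longrightarrow> j \<in> S \<Longrightarrow> (i, k) \<in> R \<Longrightarrow> (k, j) \<in> R \<Longrightarrow> k \<in> S"
    and "trans R" "i \<in> S" "j \<in> S"
  shows "(i, a, j) \<in> sml P (submatrix_on S g) \<longleftrightarrow> (i, a, j) \<in> sml R g"
proof -
  \<comment> \<open>Transitivity places each of \<open>k\<close> and \<open>l\<close> between
    \<open>i\<close> and \<open>j\<close>, as convexity requires.\<close>
  have "k \<in> S \<and> l \<in> S" if "(i, k) \<in> R" "(k, l) \<in> R" "(l, j) \<in> R" for k l
    using that assms(3-) convex by (meson transD)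
  then have "(i, k) \<in> P \<and> strict_in P k l \<and> (l, j) \<in> P \<longleftrightarrow>
      (i, k) \<in> R \<and> strict_in R k l \<and> (l, j) \<in> R" for k l
    using assms(1,4,5) by (auto simp: strict_in_def)
  moreover have "submatrix_on S g k l = g k l" if "strict_in P k l" for k l
    using that assms(1) by (auto simp: submatrix_on_def strict_in_def)
  moreover have "strict_in P i j \<longleftrightarrow> strict_in R i j"
    using assms(1,4,5) by (auto simp: strict_in_def)
  ultimately show ?thesis
    unfolding sml_def mem_Collect_eq prod.case by metis
qed

lemma partial_order_on_poset_dot:
  assumes "partial_order_on S P" "partial_order_on T Q" "S \<inter> T = {}"
  shows "partial_order_on (S \<union> T) (poset_dot S P T Q)"
proof -
  have sub: "P \<subseteq> S \<times> S" "Q \<subseteq> T \<times> T"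
    using assms by (auto simp: partial_order_on_def preorder_on_def)
  have "trans (poset_dot S P T Q)"
    using assms sub
    unfolding partial_order_on_def preorder_on_def trans_def poset_dot_def by blast
  moreover have "antisym (poset_dot S P T Q)"
    using assms sub
    unfolding partial_order_on_def antisym_def poset_dot_def by blast
  ultimately show ?thesis
    using assms sub
    by (auto simp: partial_order_on_def preorder_on_def refl_on_def poset_dot_def)
qed

theorem proposition8p7:
  fixes S T :: "'i set" and P Q :: "'i rel"
    and \<eta> \<nu> :: "('i, 'k::{field, finite}) arc set"
  assumes "finite S" and "finite T" and "S \<inter> T = {}"
    and "partial_order_on S P" and "partial_order_on T Q"
    and "\<eta> \<in> NN S P" and "\<nu> \<in> NN T Q"
  shows "\<forall>g \<in> pattern_group (S \<union> T) (poset_dot S P T Q).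
           mu_prod S T (p_fun S P \<eta>) (p_fun T Q \<nu>) g =
           p_fun (S \<union> T) (poset_dot S P T Q) (\<eta> \<union> \<nu>) g"
proof
  fix g :: "('i, 'k) mat_fun"
  let ?R = "poset_dot S P T Q"
  assume g: "g \<in> pattern_group (S \<union> T) ?R"
  have po: "partial_order_on (S \<union> T) ?R"
    using assms(3-5) by (intro partial_order_on_poset_dot)
  then have tr: "trans ?R"
    by (simp add: partial_order_on_def preorder_on_def)
  have sub: "P \<subseteq> S \<times> S" "Q \<subseteq> T \<times> T"
    using assms(4,5) by (auto simp: partial_order_on_def preorder_on_def)
  \<comment> \<open>By disjointness, neither S \<times> T nor the order on the other block meets S
    \<times> S or T \<times> T.\<close>
  have P: "P = ?R \<inter> S \<times> S" and Q: "Q = ?R \<inter> T \<times> T"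
    using sub assms(3) by (auto simp: poset_dot_def)
  have gS: "submatrix_on S g \<in> pattern_group S P" and gT: "submatrix_on T g \<in> pattern_group T Q"
    using equalityD2[OF P] equalityD2[OF Q] by (auto intro!: submatrix_in_pattern_group[OF g])
  have "(i, a, j) \<in> sml P (submatrix_on S g) \<longleftrightarrow> (i, a, j) \<in> sml ?R g" if "(i, a, j) \<in> \<eta>" for i a j
  proof (rule sml_submatrix_iff[OF P _ tr])
    show "i \<in> S" "j \<in> S"
      using that assms(6) by (auto dest: NN_subset)
  \<comment> \<open>The remaining goal is convexity: \<open>S\<close> is a down-set of
    \<open>?R\<close>, and below, dually, \<open>T\<close> is an up-set.\<close>
  qed (use sub assms(3) in \<open>auto simp: poset_dot_def\<close>)
  then have \<eta>: "\<eta> \<subseteq> sml P (submatrix_on S g) \<longleftrightarrow> \<eta> \<subseteq> sml ?R g"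
    by auto
  have "(i, a, j) \<in> sml Q (submatrix_on T g) \<longleftrightarrow> (i, a, j) \<in> sml ?R g" if "(i, a, j) \<in> \<nu>" for i a j
  proof (rule sml_submatrix_iff[OF Q _ tr])
    show "i \<in> T" "j \<in> T"
      using that assms(7) by (auto dest: NN_subset)
  qed (use sub assms(3) in \<open>auto simp: poset_dot_def\<close>)
  then have \<nu>: "\<nu> \<subseteq> sml Q (submatrix_on T g) \<longleftrightarrow> \<nu> \<subseteq> sml ?R g"
    by auto
  \<comment> \<open>A product of two 0/1 values is the value of the conjunction, and the two
    containments together say that the union is contained in \<open>sml ?R g\<close>.\<close>
  show "mu_prod S T (p_fun S P \<eta>) (p_fun T Q \<nu>) g = p_fun (S \<union> T) ?R (\<eta> \<union> \<nu>) g"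
    using assms(1,2,4,5) po g gS gT by (simp add: mu_prod_def p_fun_eq \<eta> \<nu>)
qed

end
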